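(* Let $G$ be a graph on $n$ vertices, fix $k\ge\chi(G)$, and let $\alpha$ and $\beta$ be two proper $k$-colourings of $G$ that induce the same partition of the vertices into colour classes $C_1,\dots,C_k$. If $\ell\ge k+1$, then $\alpha$ can be recoloured to $\beta$ in $\mathcal{C}_\ell(G)$ in at most $\lfloor 3n/2\rfloor$ steps, with each vertex recoloured at most $2$ times.
   Context: $\chi(G)$ is the chromatic number of $G$. A $k$-colouring is a proper vertex colouring with colours from $[k]=\{1,\dots,k\}$; in particular every $k$-colouring is an $\ell$-colouring for $\ell\ge k$. The graph $\mathcal{C}_\ell(G)$ has as vertices the $\ell$-colourings of $G$; two are adjacent precisely when they differ in the colour of exactly one vertex of $G$. Recolouring $\alpha$ to $\beta$ in $\mathcal{C}_\ell(G)$ in $s$ steps means giving a walk of length $s$ from $\alpha$ to $\beta$ in $\mathcal{C}_\ell(G)$; each step recolours one vertex, and the number of times a vertex is recoloured is the number of steps of the walk in which its colour changes. *)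

theory Defs
  imports "Graph_Theory.Graph_Theory"
begin

text \<open>
  Colourings are extensional (\<^const>\<open>undefined\<close> outside the vertex set), so that they
  correspond exactly to functions on the vertices of the graph, and two colourings are equal
  iff they agree on all vertices.
\<close>

definition colourings :: "('a, 'b) pre_digraph \<Rightarrow> nat \<Rightarrow> ('a \<Rightarrow> nat) set" where
  "colourings G l =
     {\<phi> \<in> verts G \<rightarrow>\<^sub>E {1..l}. \<forall>u v. u \<rightarrow>\<^bsub>G\<^esub> v \<longrightarrow> \<phi> u \<noteq> \<phi> v}"

definition chromatic_number :: "('a, 'b) pre_digraph \<Rightarrow> nat" where
  "chromatic_number G = (LEAST k. colourings G k \<noteq> {})"

definition colour_class :: "('a, 'b) pre_digraph \<Rightarrow> ('a \<Rightarrow> nat) \<Rightarrow> nat \<Rightarrow> 'a set" where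
  "colour_class G \<phi> c = {v \<in> verts G. \<phi> v = c}"

text \<open>
  As a set of sets, hence independent of which class carries which colour.
  Unused colours contribute the empty class; it belongs to the colour partition iff
  there are fewer than \<open>k\<close> nonempty classes, so whether empty classes are kept or
  dropped does not affect equality of the partitions of two \<open>k\<close>-colourings.
\<close>

definition colour_partition :: "('a, 'b) pre_digraph \<Rightarrow> nat \<Rightarrow> ('a \<Rightarrow> nat) \<Rightarrow> 'a set set" where
  "colour_partition G k \<phi> = colour_class G \<phi> ` {1..k}"

definition recolouring_graph ::
    "('a, 'b) pre_digraph \<Rightarrow> nat \<Rightarrow> ('a \<Rightarrow> nat) pair_pre_digraph" where
  "recolouring_graph G l =
     \<lparr> pverts = colourings G l,
       parcs = {(\<phi>, \<psi>). \<phi> \<in> colourings G l \<and> \<psi> \<in> colourings G l \<and>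
                        (\<exists>!v. v \<in> verts G \<and> \<phi> v \<noteq> \<psi> v)} \<rparr>"

text \<open>
  A walk is a list of arcs, and an arc of the recolouring graph is a pair of colourings.
\<close>

definition times_recoloured :: "(('a \<Rightarrow> nat) \<times> ('a \<Rightarrow> nat)) awalk \<Rightarrow> 'a \<Rightarrow> nat" where
  "times_recoloured p v = length (filter (\<lambda>(\<phi>, \<psi>). \<phi> v \<noteq> \<psi> v) p)"

lemma colourings_mono: "k \<le> l \<Longrightarrow> colourings G k \<subseteq> colourings G l"
  by (fastforce simp: colourings_def PiE_iff)

lemma colourings_chromatic_number:
  assumes "graph G"
  shows "colourings G (chromatic_number G) \<noteq> {}"
proof -
  interpret graph G by fact
  obtain f where f: "bij_betw f (verts G) {1..card (verts G)}"
    using ex_bij_betw_finite_nat finite_verts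
    by (metis bij_betw_iff_card card_atLeastAtMost diff_Suc_1 finite_atLeastAtMost One_nat_def)
  have "restrict f (verts G) u \<noteq> restrict f (verts G) v" if "u \<rightarrow>\<^bsub>G\<^esub> v" for u v
    using that f adj_not_same adj_in_verts by (metis bij_betw_def inj_onD restrict_apply')
  moreover have "restrict f (verts G) \<in> verts G \<rightarrow>\<^sub>E {1..card (verts G)}"
    using f by (auto simp: bij_betw_def)
  ultimately have "colourings G (card (verts G)) \<noteq> {}"
    unfolding colourings_def by blast
  then show ?thesis
    unfolding chromatic_number_def by (rule LeastI)
qed

lemma pair_graph_recolouring_graph:
  assumes "graph G"
  shows "pair_graph (recolouring_graph G l)"
proof -
  interpret graph G by fact
  have fin: "finite (colourings G l)"
    by (rule finite_subset[of _ "verts G \<rightarrow>\<^sub>E {1..l}"])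
       (auto simp: colourings_def intro: finite_PiE)
  have "parcs (recolouring_graph G l) \<subseteq> colourings G l \<times> colourings G l"
    by (auto simp: recolouring_graph_def)
  then have "finite (parcs (recolouring_graph G l))"
    using fin by (meson finite_SigmaI finite_subset)
  then show ?thesis
    using fin
    by unfold_locales
       (auto simp: recolouring_graph_def symmetric_def arcs_ends_def arc_to_ends_def sym_def
         eq_commute)
qed

end

(* Both colourings have the same classes, so whole classes can be moved at once to any unused
   colour. If the target colour of some misplaced class is unused, move that class there. Otherwise
   alpha and beta use the same colours; park a smallest misplaced class A on a spare colour and move
   the class B that wants the old colour of A. Since card A <= card B, a potential charging 3 to a
   misplaced vertex and 2 to a vertex whose present colour is no longer wanted by any class decreases
   by at least twice the number of steps. This avoids decomposing the permutation of the colours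
   into cycles. *)
theory Submission
  imports Defs
begin

section \<open>Walks in the recolouring graph\<close>

abbreviation recolouring_walk ::
    "('a, 'b) pre_digraph \<Rightarrow> nat \<Rightarrow> ('a \<Rightarrow> nat) \<Rightarrow> (('a \<Rightarrow> nat) \<times> ('a \<Rightarrow> nat)) awalk \<Rightarrow>
      ('a \<Rightarrow> nat) \<Rightarrow> bool" where
  "recolouring_walk G l \<equiv> pre_digraph.awalk (with_proj (recolouring_graph G l))"

lemma recolouring_walk_Nil:
  "\<phi> \<in> colourings G l \<Longrightarrow> recolouring_walk G l \<phi> [] \<phi>"
  by (simp add: pre_digraph.awalk_def pre_digraph.cas.simps recolouring_graph_def)

lemma recolouring_walk_append:
  assumes "graph G" "recolouring_walk G l \<phi> p \<psi>" "recolouring_walk G l \<psi> q \<chi>"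
  shows "recolouring_walk G l \<phi> (p @ q) \<chi>"
proof -
  interpret R: pair_graph "recolouring_graph G l"
    by (rule pair_graph_recolouring_graph) fact
  show ?thesis
    using assms(2,3) by (auto simp: R.awalk_append_iff)
qed

lemma recolouring_walk_single:
  assumes "\<phi> \<in> colourings G l" "\<psi> \<in> colourings G l" "v \<in> verts G" "\<phi> v \<noteq> \<psi> v"
    and "\<And>u. u \<in> verts G \<Longrightarrow> u \<noteq> v \<Longrightarrow> \<phi> u = \<psi> u"
  shows "recolouring_walk G l \<phi> [(\<phi>, \<psi>)] \<psi>"
proof -
  have "\<exists>!v. v \<in> verts G \<and> \<phi> v \<noteq> \<psi> v"
    using assms by metis
  then show ?thesis
    using assms by (simp add: pre_digraph.awalk_def pre_digraph.cas.simps recolouring_graph_def)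
qed

lemma times_recoloured_Nil [simp]: "times_recoloured [] v = 0"
  by (simp add: times_recoloured_def)

lemma times_recoloured_append [simp]:
  "times_recoloured (p @ q) v = times_recoloured p v + times_recoloured q v"
  by (simp add: times_recoloured_def)

definition recolour_on :: "'a set \<Rightarrow> nat \<Rightarrow> ('a \<Rightarrow> nat) \<Rightarrow> 'a \<Rightarrow> nat" where
  "recolour_on S b \<phi> v = (if v \<in> S then b else \<phi> v)"

text \<open>A colour class is independent and \<open>b\<close> occurs nowhere under
  \<open>\<phi>\<close>, so no edge becomes monochromatic. Allowing any subset \<open>S\<close> of
  the class covers the intermediate colourings that arise while the class is moved vertex by
  vertex.\<close>

lemma recolour_on_in_colourings:
  assumes "graph G" "\<phi> \<in> colourings G l" "S \<subseteq> colour_class G \<phi> a"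
    and "b \<in> {1..l}" "b \<notin> \<phi> ` verts G"
  shows "recolour_on S b \<phi> \<in> colourings G l"
proof -
  interpret graph G by fact
  have S: "v \<in> verts G" "\<phi> v = a" if "v \<in> S" for v
    using that assms(3) by (auto simp: colour_class_def)
  have "recolour_on S b \<phi> \<in> verts G \<rightarrow>\<^sub>E {1..l}"
    using assms(2,4) S(1) by (auto simp: colourings_def recolour_on_def PiE_iff extensional_def)
  moreover have "recolour_on S b \<phi> u \<noteq> recolour_on S b \<phi> v" if "u \<rightarrow>\<^bsub>G\<^esub> v" for u v
  proof -
    have "\<phi> u \<noteq> \<phi> v"
      using that assms(2) by (simp add: colourings_def)
    moreover have "b \<noteq> \<phi> u" "b \<noteq> \<phi> v"
      using assms(5) adj_in_verts[OF that] by auto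
    ultimately show ?thesis
      using S(2)[of u] S(2)[of v] by (auto simp: recolour_on_def)
  qed
  ultimately show ?thesis
    by (simp add: colourings_def)
qed

lemma recolour_class_walk:
  assumes "graph G" "\<phi> \<in> colourings G l" "S \<subseteq> colour_class G \<phi> a"
    and "b \<in> {1..l}" "b \<notin> \<phi> ` verts G"
  shows "\<exists>p. recolouring_walk G l \<phi> p (recolour_on S b \<phi>) \<and> length p = card S \<and>
    (\<forall>v. times_recoloured p v = of_bool (v \<in> S))"
proof -
  interpret graph G by fact
  have "finite S"
    using assms(3) finite_verts by (auto simp: colour_class_def intro: finite_subset)
  then show ?thesis
    using assms(3)
  proof (induction S)
    case empty
    have "recolour_on {} b \<phi> = \<phi>"
      by (simp add: recolour_on_def fun_eq_iff)
    then show ?case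
      using recolouring_walk_Nil[OF assms(2)] by auto
  next
    case (insert x S)
    let ?\<psi> = "recolour_on S b \<phi>" and ?\<chi> = "recolour_on (insert x S) b \<phi>"
    obtain p where p: "recolouring_walk G l \<phi> p ?\<psi>" "length p = card S"
      "\<forall>v. times_recoloured p v = of_bool (v \<in> S)"
      using insert by auto
    have x: "x \<in> verts G" "\<phi> x \<noteq> b"
      using insert.prems assms(5) by (auto simp: colour_class_def)
    have "recolouring_walk G l ?\<psi> [(?\<psi>, ?\<chi>)] ?\<chi>"
    proof (rule recolouring_walk_single)
      show "?\<psi> \<in> colourings G l" "?\<chi> \<in> colourings G l"
        using recolour_on_in_colourings[OF assms(1,2) _ assms(4,5)] insert.prems by auto
    qed (use x insert.hyps in \<open>auto simp: recolour_on_def\<close>)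
    then have "recolouring_walk G l \<phi> (p @ [(?\<psi>, ?\<chi>)]) ?\<chi>"
      using p(1) recolouring_walk_append[OF assms(1)] by blast
    moreover have "times_recoloured (p @ [(?\<psi>, ?\<chi>)]) v = of_bool (v \<in> insert x S)" for v
      using p(3) x insert.hyps by (auto simp: times_recoloured_def recolour_on_def)
    ultimately show ?case
      using p(2) insert.hyps by (intro exI[of _ "p @ [(?\<psi>, ?\<chi>)]"]) auto
  qed
qed

section \<open>Colourings with the same classes\<close>

definition same_classes :: "'a set \<Rightarrow> ('a \<Rightarrow> nat) \<Rightarrow> ('a \<Rightarrow> nat) \<Rightarrow> bool" where
  "same_classes V \<phi> \<psi> \<longleftrightarrow> (\<forall>u\<in>V. \<forall>v\<in>V. \<phi> u = \<phi> v \<longleftrightarrow> \<psi> u = \<psi> v)"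

text \<open>Sending the \<open>\<phi>\<close>-colour of a vertex to its \<open>\<psi>\<close>-colour
  is well defined and injective because the two kernels agree; \<open>f\<close> realises this map by
  choosing a representative of each class.\<close>

lemma same_classes_card_image:
  assumes "same_classes V \<phi> \<psi>"
  shows "card (\<phi> ` V) = card (\<psi> ` V)"
proof -
  define f where "f c = \<psi> (SOME v. v \<in> V \<and> \<phi> v = c)" for c
  have f: "f (\<phi> v) = \<psi> v" if "v \<in> V" for v
    using someI[of "\<lambda>u. u \<in> V \<and> \<phi> u = \<phi> v" v] that assms
    unfolding f_def same_classes_def by blast
  have "inj_on f (\<phi> ` V)"
    using f assms by (auto simp: inj_on_def same_classes_def)
  moreover have "f ` \<phi> ` V = \<psi> ` V"
    using f by (force simp: image_iff)
  ultimately show ?thesis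
    by (metis card_image)
qed

lemma same_classes_recolour_class:
  assumes "same_classes (verts G) \<phi> \<psi>" "b \<notin> \<phi> ` verts G"
  shows "same_classes (verts G) (recolour_on (colour_class G \<phi> a) b \<phi>) \<psi>"
  using assms unfolding same_classes_def recolour_on_def colour_class_def by auto

text \<open>The \<open>\<phi>\<close>-class of \<open>v\<close> is also some
  \<open>\<psi>\<close>-class, and since it contains \<open>v\<close>, it must be the one of colour
  \<open>\<psi> v\<close>.\<close>

lemma same_classes_if_colour_partition_eq:
  assumes "\<phi> \<in> colourings G k" "\<psi> \<in> colourings G k"
    and "colour_partition G k \<phi> = colour_partition G k \<psi>"
  shows "same_classes (verts G) \<phi> \<psi>"
proof -
  have "colour_class G \<phi> (\<phi> v) = colour_class G \<psi> (\<psi> v)" if "v \<in> verts G" for v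
  proof -
    have "\<phi> v \<in> {1..k}"
      using assms(1) that by (auto simp: colourings_def)
    then have "colour_class G \<phi> (\<phi> v) \<in> colour_partition G k \<psi>"
      using assms(3) unfolding colour_partition_def by blast
    then obtain c where c: "colour_class G \<phi> (\<phi> v) = colour_class G \<psi> c"
      by (auto simp: colour_partition_def)
    moreover have "v \<in> colour_class G \<phi> (\<phi> v)"
      using that by (simp add: colour_class_def)
    ultimately show ?thesis
      by (auto simp: colour_class_def)
  qed
  then show ?thesis
    unfolding same_classes_def colour_class_def by blast
qed

section \<open>Potential and induction on misplaced vertices\<close>

definition recolour_cap :: "'a set \<Rightarrow> ('a \<Rightarrow> nat) \<Rightarrow> ('a \<Rightarrow> nat) \<Rightarrow> 'a \<Rightarrow> nat" where
  "recolour_cap V \<beta> \<gamma> v = (if \<gamma> v = \<beta> v then 0 else if \<gamma> v \<in> \<beta> ` V then 2 else 1)"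

text \<open>The weight is twice the number of steps charged to a vertex, which keeps the average 3/2
  integral. A misplaced vertex on a colour that \<open>\<beta>\<close> does not use is never parked
  again: it needs a single move, hence cap 1 and weight 2. Any other misplaced vertex may have to be
  parked first, hence cap 2.\<close>

definition recolour_weight :: "'a set \<Rightarrow> ('a \<Rightarrow> nat) \<Rightarrow> ('a \<Rightarrow> nat) \<Rightarrow> 'a \<Rightarrow> nat" where
  "recolour_weight V \<beta> \<gamma> v = (if \<gamma> v = \<beta> v then 0 else if \<gamma> v \<in> \<beta> ` V then 3 else 2)"

lemma card_eq_sum_of_bool:
  assumes "finite V" "S \<subseteq> V"
  shows "card S = (\<Sum>v\<in>V. of_bool (v \<in> S))"
  using assms by (simp add: Int_absorb1)

text \<open>The weights bound only the total length, so the caps are carried through the induction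
  as a separate per-vertex bound. The condition on \<open>l\<close> refers to \<open>\<beta>\<close>
  alone and therefore survives every change of \<open>\<gamma>\<close>.\<close>

lemma recolouring_walk_within_caps:
  assumes "graph G" "\<beta> \<in> colourings G l" "card (\<beta> ` verts G) < l"
    and "\<gamma> \<in> colourings G l" "same_classes (verts G) \<gamma> \<beta>"
  shows "\<exists>p. recolouring_walk G l \<gamma> p \<beta> \<and>
    2 * length p \<le> (\<Sum>v\<in>verts G. recolour_weight (verts G) \<beta> \<gamma> v) \<and>
    (\<forall>v\<in>verts G. times_recoloured p v \<le> recolour_cap (verts G) \<beta> \<gamma> v)"
  using assms(4,5)
proof (induction "card {v \<in> verts G. \<gamma> v \<noteq> \<beta> v}" arbitrary: \<gamma> rule: less_induct)
  case less
  interpret graph G by fact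
  let ?V = "verts G" and ?w = "recolour_weight (verts G) \<beta>" and ?cap = "recolour_cap (verts G) \<beta>"
  let ?cl = "\<lambda>u. colour_class G \<gamma> (\<gamma> u)"
  have card_cl: "card (?cl u) = (\<Sum>v\<in>?V. of_bool (v \<in> ?cl u))" for u
    by (rule card_eq_sum_of_bool) (auto simp: colour_class_def)
  have kernel: "\<gamma> u = \<gamma> v \<longleftrightarrow> \<beta> u = \<beta> v" if "u \<in> ?V" "v \<in> ?V" for u v
    using less.prems(2) that by (auto simp: same_classes_def)
  have range_\<beta>: "\<beta> u \<in> {1..l}" and range_\<gamma>: "\<gamma> u \<in> {1..l}" if "u \<in> ?V" for u
    using assms(2) less.prems(1) that by (auto simp: colourings_def)
  consider (finished) "\<forall>v\<in>?V. \<gamma> v = \<beta> v"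
    | (direct) x where "x \<in> ?V" "\<gamma> x \<noteq> \<beta> x" "\<beta> x \<notin> \<gamma> ` ?V"
    | (swap) "\<exists>x. x \<in> ?V \<and> \<gamma> x \<noteq> \<beta> x" "\<forall>x\<in>?V. \<beta> x \<in> \<gamma> ` ?V"
    by (cases "\<forall>v\<in>?V. \<gamma> v = \<beta> v") (force, metis imageI)
  then show ?case
  proof cases
    case finished
    \<comment> \<open>Colourings are extensional, so agreement on the vertices is equality.\<close>
    then have "\<gamma> = \<beta>"
      using assms(2) less.prems(1) by (auto simp: colourings_def intro: PiE_ext)
    then show ?thesis
      using recolouring_walk_Nil[OF assms(2)] by (intro exI[of _ "[]"]) simp
  next
    case direct
    define \<delta> where "\<delta> = recolour_on (?cl x) (\<beta> x) \<gamma>"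
    \<comment> \<open>\<open>\<beta>\<close> is constant on the class of \<open>x\<close>, so the
      move puts the whole class in its final place.\<close>
    have \<delta>: "\<delta> v = (if v \<in> ?cl x then \<beta> v else \<gamma> v)" if "v \<in> ?V" for v
      using kernel[OF that direct(1)] by (auto simp: \<delta>_def recolour_on_def colour_class_def)
    have "\<delta> \<in> colourings G l"
      unfolding \<delta>_def using assms(1) less.prems(1) direct range_\<beta>
      by (intro recolour_on_in_colourings) auto
    moreover have "same_classes ?V \<delta> \<beta>"
      unfolding \<delta>_def using less.prems(2) direct(3) by (rule same_classes_recolour_class)
    moreover have "card {v \<in> ?V. \<delta> v \<noteq> \<beta> v} < card {v \<in> ?V. \<gamma> v \<noteq> \<beta> v}"
    proof (rule psubset_card_mono)
      have "\<delta> x = \<beta> x"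
        using \<delta> direct(1) by (simp add: colour_class_def)
      moreover have "{v \<in> ?V. \<delta> v \<noteq> \<beta> v} \<subseteq> {v \<in> ?V. \<gamma> v \<noteq> \<beta> v}"
        using \<delta> by (auto split: if_splits)
      ultimately show "{v \<in> ?V. \<delta> v \<noteq> \<beta> v} \<subset> {v \<in> ?V. \<gamma> v \<noteq> \<beta> v}"
        using direct(1,2) by blast
    qed simp
    ultimately obtain q where q: "recolouring_walk G l \<delta> q \<beta>"
      "2 * length q \<le> (\<Sum>v\<in>?V. ?w \<delta> v)" "\<forall>v\<in>?V. times_recoloured q v \<le> ?cap \<delta> v"
      using less.hyps by blast
    obtain p where p: "recolouring_walk G l \<gamma> p \<delta>" "length p = card (?cl x)"
      "\<forall>v. times_recoloured p v = of_bool (v \<in> ?cl x)"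
      unfolding \<delta>_def
      using recolour_class_walk[OF assms(1) less.prems(1) order_refl range_\<beta>[OF direct(1)] direct(3)]
      by blast
    have misplaced: "\<gamma> v \<noteq> \<beta> v" if "v \<in> ?cl x" for v
      using that direct kernel[of v x] by (auto simp: colour_class_def)
    \<comment> \<open>A moved vertex drops from weight 2 or 3 to 0, which pays the 2 units for its
      single step; all other weights are unchanged.\<close>
    have "?w \<delta> v + 2 * of_bool (v \<in> ?cl x) \<le> ?w \<gamma> v" if "v \<in> ?V" for v
      using \<delta>[OF that] misplaced by (auto simp: recolour_weight_def)
    then have "(\<Sum>v\<in>?V. ?w \<delta> v + 2 * of_bool (v \<in> ?cl x)) \<le> (\<Sum>v\<in>?V. ?w \<gamma> v)"
      by (rule sum_mono)
    then have "(\<Sum>v\<in>?V. ?w \<delta> v) + 2 * card (?cl x) \<le> (\<Sum>v\<in>?V. ?w \<gamma> v)"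
      by (simp only: sum.distrib card_cl flip: sum_distrib_left)
    then have "2 * length (p @ q) \<le> (\<Sum>v\<in>?V. ?w \<gamma> v)"
      using q(2) p(2) by simp
    moreover have "times_recoloured (p @ q) v \<le> ?cap \<gamma> v" if v: "v \<in> ?V" for v
      using q(3)[rule_format, OF v] p(3) \<delta>[OF v] misplaced[of v]
      by (auto simp: recolour_cap_def split: if_splits)
    ultimately show ?thesis
      using recolouring_walk_append[OF assms(1) p(1) q(1)] by blast
  next
    case swap
    have "\<beta> ` ?V \<subseteq> \<gamma> ` ?V"
      using swap(2) by blast
    \<comment> \<open>Equal kernels give equally many colours, so the inclusion is an equality.
      Hence every colour now in use is wanted, and every misplaced vertex has weight 3 and cap
      2.\<close>
    then have images: "\<beta> ` ?V = \<gamma> ` ?V"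
      using same_classes_card_image[OF less.prems(2)] by (intro card_subset_eq) auto
    obtain x where x: "x \<in> ?V" "\<gamma> x \<noteq> \<beta> x"
      and x_min: "\<And>y. y \<in> ?V \<Longrightarrow> \<gamma> y \<noteq> \<beta> y \<Longrightarrow> card (?cl x) \<le> card (?cl y)"
      using ex_has_least_nat[of "\<lambda>x. x \<in> ?V \<and> \<gamma> x \<noteq> \<beta> x" _ "\<lambda>x. card (?cl x)"] swap(1) by blast
    obtain y where y: "y \<in> ?V" "\<beta> y = \<gamma> x"
      using images x(1) by (metis imageE imageI)
    \<comment> \<open>If \<open>y\<close> shared the class of \<open>x\<close>, then
      \<open>\<beta> x = \<beta> y = \<gamma> x\<close>, although \<open>x\<close> is
      misplaced.\<close>
    have xy: "\<gamma> y \<noteq> \<gamma> x" "\<gamma> y \<noteq> \<beta> y"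
      using kernel[OF x(1) y(1)] x(2) y(2) by auto
    obtain c where c: "c \<in> {1..l}" "c \<notin> \<gamma> ` ?V"
    proof -
      have "\<not> {1..l} \<subseteq> \<gamma> ` ?V"
        using assms(3) images card_mono[of "\<gamma> ` ?V" "{1..l}"] by auto
      then show thesis
        using that by blast
    qed
    define \<gamma>' where "\<gamma>' = recolour_on (?cl x) c \<gamma>"
    define \<delta> where "\<delta> = recolour_on (?cl y) (\<gamma> x) \<gamma>'"
    have disjoint: "?cl x \<inter> ?cl y = {}"
      using xy(1) by (auto simp: colour_class_def)
    \<comment> \<open>The second move starts from \<open>\<gamma>'\<close>, so the class of
      \<open>y\<close> has to be recognised as a class of \<open>\<gamma>'\<close>. Parking did not
      touch it, and \<open>c\<close> differs from its colour.\<close>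
    have cl_y: "?cl y = colour_class G \<gamma>' (\<gamma> y)"
      using xy(1) y(1) c(2) by (auto simp: colour_class_def \<gamma>'_def recolour_on_def)
    have free: "\<gamma> x \<notin> \<gamma>' ` ?V"
      using x(1) c(2) by (auto simp: colour_class_def \<gamma>'_def recolour_on_def)
    have \<delta>: "\<delta> v = (if v \<in> ?cl x then c else if v \<in> ?cl y then \<beta> v else \<gamma> v)" if "v \<in> ?V" for v
      using kernel[OF that y(1)] y(2) disjoint
      by (auto simp: \<delta>_def \<gamma>'_def recolour_on_def colour_class_def)
    have \<gamma>': "\<gamma>' \<in> colourings G l"
      unfolding \<gamma>'_def using assms(1) less.prems(1) c
      by (intro recolour_on_in_colourings) auto
    have "\<delta> \<in> colourings G l"
      unfolding \<delta>_def cl_y using assms(1) \<gamma>' free range_\<gamma>[OF x(1)]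
      by (intro recolour_on_in_colourings) auto
    moreover have "same_classes ?V \<delta> \<beta>"
      unfolding \<delta>_def cl_y using less.prems(2) c(2) free
      by (metis \<gamma>'_def same_classes_recolour_class)
    moreover have misplaced: "\<gamma> v \<noteq> \<beta> v" if "v \<in> ?cl x \<union> ?cl y" for v
      using that x y xy kernel[of v x] kernel[of v y] by (auto simp: colour_class_def)
    \<comment> \<open>The parked class stays misplaced; the measure drops because the class of
      \<open>y\<close> reaches its target.\<close>
    moreover have "card {v \<in> ?V. \<delta> v \<noteq> \<beta> v} < card {v \<in> ?V. \<gamma> v \<noteq> \<beta> v}"
    proof (rule psubset_card_mono)
      have "y \<in> ?cl y" "y \<notin> ?cl x"
        using y(1) xy(1) by (auto simp: colour_class_def)
      then have "\<delta> y = \<beta> y"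
        using \<delta> y(1) by simp
      moreover have "{v \<in> ?V. \<delta> v \<noteq> \<beta> v} \<subseteq> {v \<in> ?V. \<gamma> v \<noteq> \<beta> v}"
        using \<delta> misplaced by (auto split: if_splits)
      ultimately show "{v \<in> ?V. \<delta> v \<noteq> \<beta> v} \<subset> {v \<in> ?V. \<gamma> v \<noteq> \<beta> v}"
        using y(1) xy(2) by blast
    qed simp
    ultimately obtain q where q: "recolouring_walk G l \<delta> q \<beta>"
      "2 * length q \<le> (\<Sum>v\<in>?V. ?w \<delta> v)" "\<forall>v\<in>?V. times_recoloured q v \<le> ?cap \<delta> v"
      using less.hyps by blast
    obtain p where p: "recolouring_walk G l \<gamma> p \<gamma>'" "length p = card (?cl x)"
      "\<forall>v. times_recoloured p v = of_bool (v \<in> ?cl x)"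
      unfolding \<gamma>'_def
      using recolour_class_walk[OF assms(1) less.prems(1) order_refl c] by blast
    obtain r where r: "recolouring_walk G l \<gamma>' r \<delta>" "length r = card (?cl y)"
      "\<forall>v. times_recoloured r v = of_bool (v \<in> ?cl y)"
      unfolding \<delta>_def cl_y
      using recolour_class_walk[OF assms(1) \<gamma>' order_refl range_\<gamma>[OF x(1)] free] by blast
    have c_unwanted: "c \<notin> \<beta> ` ?V"
      using images c(2) by simp
    have wanted: "\<gamma> v \<in> \<beta> ` ?V" if "v \<in> ?V" for v
      using images that by simp
    \<comment> \<open>Parked vertices go from weight 3 to 2 because \<open>c\<close> is unwanted;
      vertices in the class of \<open>y\<close> go from 3 to 0.\<close>
    have "?w \<delta> v + of_bool (v \<in> ?cl x) + 3 * of_bool (v \<in> ?cl y) \<le> ?w \<gamma> v" if "v \<in> ?V" for v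
      using \<delta>[OF that] misplaced[of v] c_unwanted wanted[OF that] disjoint that
      by (auto simp: recolour_weight_def)
    then have "(\<Sum>v\<in>?V. ?w \<delta> v + of_bool (v \<in> ?cl x) + 3 * of_bool (v \<in> ?cl y))
        \<le> (\<Sum>v\<in>?V. ?w \<gamma> v)"
      by (rule sum_mono)
    then have "(\<Sum>v\<in>?V. ?w \<delta> v) + card (?cl x) + 3 * card (?cl y) \<le> (\<Sum>v\<in>?V. ?w \<gamma> v)"
      by (simp only: sum.distrib card_cl flip: sum_distrib_left)
    \<comment> \<open>With a and b the sizes of the classes of \<open>x\<close> and
      \<open>y\<close>, minimality gives a \<le> b, so 2(a + b) \<le> a + 3b: the surplus of the
      placed class pays for the parking.\<close>
    then have "2 * length (p @ r @ q) \<le> (\<Sum>v\<in>?V. ?w \<gamma> v)"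
      using q(2) p(2) r(2) x_min[OF y(1) xy(2)] by simp
    \<comment> \<open>A parked vertex spends one of its two recolourings and keeps cap 1; a vertex
      in the class of \<open>y\<close> is moved once and then has cap 0.\<close>
    moreover have "times_recoloured (p @ r @ q) v \<le> ?cap \<gamma> v" if v: "v \<in> ?V" for v
      using q(3)[rule_format, OF v] p(3) r(3) \<delta>[OF v] misplaced[of v] c_unwanted wanted[OF v]
        disjoint v
      by (auto simp: recolour_cap_def split: if_splits)
    ultimately show ?thesis
      using recolouring_walk_append[OF assms(1) p(1) recolouring_walk_append[OF assms(1) r(1) q(1)]]
      by blast
  qed
qed

theorem mainTheorem3:
  fixes G :: "('a, 'b) pre_digraph"
    and n k l :: nat
    and \<alpha> \<beta> :: "'a \<Rightarrow> nat"
  assumes "graph G"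
    and "card (verts G) = n"
    and "k \<ge> chromatic_number G"
    and "\<alpha> \<in> colourings G k"
    and "\<beta> \<in> colourings G k"
    and "colour_partition G k \<alpha> = colour_partition G k \<beta>"
    and "l \<ge> k + 1"
  shows "\<exists>p. pre_digraph.awalk (with_proj (recolouring_graph G l)) \<alpha> p \<beta> \<and>
             int (length p) \<le> \<lfloor>3 * real n / 2\<rfloor> \<and>
             (\<forall>v \<in> verts G. times_recoloured p v \<le> 2)"
proof -
  have "\<beta> ` verts G \<subseteq> {1..k}"
    using assms(5) by (auto simp: colourings_def)
  then have "card (\<beta> ` verts G) \<le> card {1..k}"
    by (intro card_mono) auto
  \<comment> \<open>The extra colour in \<open>l \<ge> k + 1\<close> is what guarantees a spare
    colour for parking.\<close>
  then have few: "card (\<beta> ` verts G) < l"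
    using assms(7) by simp
  have "\<alpha> \<in> colourings G l" "\<beta> \<in> colourings G l"
    using assms(4,5,7) colourings_mono[of k l G] by auto
  then obtain p where p: "recolouring_walk G l \<alpha> p \<beta>"
    "2 * length p \<le> (\<Sum>v\<in>verts G. recolour_weight (verts G) \<beta> \<alpha> v)"
    "\<forall>v\<in>verts G. times_recoloured p v \<le> recolour_cap (verts G) \<beta> \<alpha> v"
    using recolouring_walk_within_caps[OF assms(1) _ few]
      same_classes_if_colour_partition_eq[OF assms(4-6)] by blast
  \<comment> \<open>Every weight is at most 3, the worst case being that all vertices are misplaced
    on wanted colours.\<close>
  have "(\<Sum>v\<in>verts G. recolour_weight (verts G) \<beta> \<alpha> v) \<le> of_nat (card (verts G)) * 3"
    by (rule sum_bounded_above) (simp add: recolour_weight_def)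
  then have "2 * length p \<le> 3 * n"
    using p(2) assms(2) by simp
  then have "int (length p) \<le> \<lfloor>3 * real n / 2\<rfloor>"
    by (simp add: le_floor_iff)
  moreover have "times_recoloured p v \<le> 2" if "v \<in> verts G" for v
    using p(3)[rule_format, OF that] by (simp add: recolour_cap_def split: if_splits)
  ultimately show ?thesis
    using p(1) by blast
qed

end
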